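(* Let $n$ be an odd positive integer, $S=\{0,\dots,n-1\}$, and let $\alpha_1,\alpha_2,\alpha_3\in\{1,\dots,n-1\}$. Define the $n\times n\times n$ array $C$ by $C_{ijk}\equiv\alpha_1 i+\alpha_2 j+\alpha_3 k\pmod n$, $i,j,k\in S$, $C_{ijk}\in S$. Suppose, with $A=\alpha_1+\alpha_2+\alpha_3$: $\gcd(\alpha_\ell,n)=1$ for $\ell=1,2,3$; $\gcd(\alpha_\ell+\alpha_{\ell'},n)=1$ and $\gcd(\alpha_\ell-\alpha_{\ell'},n)=1$ for all $\ell\ne\ell'$ in $\{1,2,3\}$; $\gcd(A,n)=1$; and $\gcd(A-2\alpha_\ell,n)=1$ for $\ell=1,2,3$. Then $C$ is a pandiagonal latin cube.
   Context: An $n\times n$ array $(A_{xy})_{x,y\in S}$ with entries in $S$ is a pandiagonal latin square if for each $c\in S$ each of the index sets $\{(x,c)\}_x$, $\{(c,y)\}_y$, $\{(x,x+c\bmod n)\}_x$, $\{(x,c-x\bmod n)\}_x$ contains each element of $S$ exactly once among its entries. The $3n+6$ constituent squares of an $n\times n\times n$ array $C$ are: the $3n$ squares obtained by fixing one of $i,j,k$ to a value in $S$ (indexed by the other two coordinates), and the six diagonal squares $(C_{iik})_{i,k}$, $(C_{i,n-1-i,k})_{i,k}$, $(C_{iji})_{i,j}$, $(C_{i,j,n-1-i})_{i,j}$, $(C_{ijj})_{i,j}$, $(C_{i,j,n-1-j})_{i,j}$. $C$ (with entries in $S$) is a pandiagonal latin cube if each of its $3n+6$ constituent squares is a pandiagonal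 latin square. *)

theory Defs
  imports "HOL-Number_Theory.Cong"
begin

text \<open>
  Arrays of order \<open>n\<close> are functions on \<^typ>\<open>int\<close> of which only the values at indices in
  \<open>{0..<n}\<close> matter; integers are used so that \<open>c - x\<close> and \<open>n - 1 - i\<close> are not truncated.
\<close>

definition pandiagonal_latin_square :: "int \<Rightarrow> (int \<Rightarrow> int \<Rightarrow> int) \<Rightarrow> bool" where
  "pandiagonal_latin_square n A \<longleftrightarrow>
     (\<forall>x\<in>{0..<n}. \<forall>y\<in>{0..<n}. A x y \<in> {0..<n}) \<and>
     (\<forall>c\<in>{0..<n}. \<forall>s\<in>{0..<n}.
        (\<exists>!x. x \<in> {0..<n} \<and> A x c = s) \<and>
        (\<exists>!y. y \<in> {0..<n} \<and> A c y = s) \<and>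
        (\<exists>!x. x \<in> {0..<n} \<and> A x ((x + c) mod n) = s) \<and>
        (\<exists>!x. x \<in> {0..<n} \<and> A x ((c - x) mod n) = s))"

definition constituent_squares ::
    "int \<Rightarrow> (int \<Rightarrow> int \<Rightarrow> int \<Rightarrow> int) \<Rightarrow> (int \<Rightarrow> int \<Rightarrow> int) set" where
  "constituent_squares n C =
     {\<lambda>j k. C i j k | i. i \<in> {0..<n}} \<union>
     {\<lambda>i k. C i j k | j. j \<in> {0..<n}} \<union>
     {\<lambda>i j. C i j k | k. k \<in> {0..<n}} \<union>
     {\<lambda>i k. C i i k, \<lambda>i k. C i (n - 1 - i) k,
      \<lambda>i j. C i j i, \<lambda>i j. C i j (n - 1 - i),
      \<lambda>i j. C i j j, \<lambda>i j. C i j (n - 1 - j)}"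

definition pandiagonal_latin_cube :: "int \<Rightarrow> (int \<Rightarrow> int \<Rightarrow> int \<Rightarrow> int) \<Rightarrow> bool" where
  "pandiagonal_latin_cube n C \<longleftrightarrow>
     (\<forall>i\<in>{0..<n}. \<forall>j\<in>{0..<n}. \<forall>k\<in>{0..<n}. C i j k \<in> {0..<n}) \<and>
     (\<forall>A\<in>constituent_squares n C. pandiagonal_latin_square n A)"

end

theory Submission
  imports Defs
begin

text \<open>
  Modulo \<open>n\<close>, every constituent square is affine, \<open>(x, y) \<mapsto> a x + b y + c\<close>, and along a row,
  column or broken diagonal it is affine in one variable with slope \<open>b\<close>, \<open>a\<close>, \<open>a + b\<close> or
  \<open>a - b\<close>. A line takes every value once as soon as its slope is a unit; the gcd hypotheses
  say that all slopes that occur are units, up to sign.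
\<close>

text \<open>A unit slope cancels, so \<open>f\<close> is injective on the finite set
  \<open>{0..<n}\<close>, which it maps into itself; hence it is also onto. Requiring only a
  congruence leaves \<open>f\<close> free to be a reduced or merely restricted affine map.\<close>

lemma affine_mod_ex1:
  fixes n p q s :: int and f :: "int \<Rightarrow> int"
  assumes "n > 0" and "coprime p n" and s: "s \<in> {0..<n}"
    and f: "\<And>x. x \<in> {0..<n} \<Longrightarrow> f x \<in> {0..<n} \<and> [f x = p * x + q] (mod n)"
  shows "\<exists>!x. x \<in> {0..<n} \<and> f x = s"
proof -
  have inj: "inj_on f {0..<n}"
  proof (rule inj_onI)
    fix x y assume x: "x \<in> {0..<n}" and y: "y \<in> {0..<n}" and eq: "f x = f y"
    have "[p * x + q = p * y + q] (mod n)"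
      using f[OF x] f[OF y] eq by (metis cong_sym cong_trans)
    then have "[x = y] (mod n)"
      using \<open>coprime p n\<close> by (simp add: cong_add_rcancel cong_mult_lcancel)
    then show "x = y"
      using x y by (auto intro: cong_less_imp_eq_int)
  qed
  have "f ` {0..<n} = {0..<n}"
    by (rule endo_inj_surj) (use f inj in auto)
  then have "\<exists>x. x \<in> {0..<n} \<and> f x = s"
    using s by (metis imageE)
  then show ?thesis
    using inj by (metis inj_onD)
qed

text \<open>Reduces each constituent square to four coprimality checks. The constant
  \<open>c\<close> is arbitrary, so it can absorb a fixed coordinate or the \<open>n - 1\<close> of
  a reflected one.\<close>

lemma affine_imp_pandiagonal_latin_square:
  fixes n a b c :: int
  assumes n: "n > 0"
    and cop: "coprime a n" "coprime b n" "coprime (a + b) n" "coprime (a - b) n"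
    and M: "\<And>x y. \<lbrakk>x \<in> {0..<n}; y \<in> {0..<n}\<rbrakk> \<Longrightarrow>
              M x y \<in> {0..<n} \<and> [M x y = a * x + b * y + c] (mod n)"
  shows "pandiagonal_latin_square n M"
  unfolding pandiagonal_latin_square_def
proof (intro conjI ballI)
  fix x y assume "x \<in> {0..<n}" "y \<in> {0..<n}"
  then show "M x y \<in> {0..<n}" using M by blast
next
  fix d s assume d: "d \<in> {0..<n}" and s: "s \<in> {0..<n}"
  have mod_in: "z mod n \<in> {0..<n}" for z using n by simp
  \<comment> \<open>Wrapping an index around does not change the entry modulo \<open>n\<close>, so
    the broken diagonals may be computed with the unreduced \<open>z\<close>, here
    \<open>x + d\<close> or \<open>d - x\<close>.\<close>
  have line: "M x (z mod n) \<in> {0..<n} \<and> [M x (z mod n) = p * x + q] (mod n)"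
    if "x \<in> {0..<n}" and "a * x + b * z + c = p * x + q" for x z p q
  proof -
    have "[a * x + b * (z mod n) + c = a * x + b * z + c] (mod n)"
      by (intro cong_add cong_mult cong_refl) (simp add: cong_def)
    then show ?thesis using M[OF that(1) mod_in, of z] that(2) by (metis cong_trans)
  qed
  show "\<exists>!x. x \<in> {0..<n} \<and> M x d = s"
    by (rule affine_mod_ex1[OF n cop(1) s, where q = "b * d + c"])
      (use M[OF _ d] in \<open>simp add: algebra_simps\<close>)
  show "\<exists>!y. y \<in> {0..<n} \<and> M d y = s"
    by (rule affine_mod_ex1[OF n cop(2) s, where q = "a * d + c"])
      (use M[OF d] in \<open>simp add: algebra_simps\<close>)
  show "\<exists>!x. x \<in> {0..<n} \<and> M x ((x + d) mod n) = s"
    by (rule affine_mod_ex1[OF n cop(3) s, where q = "b * d + c"], rule line)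
      (simp_all add: algebra_simps)
  show "\<exists>!x. x \<in> {0..<n} \<and> M x ((d - x) mod n) = s"
    by (rule affine_mod_ex1[OF n cop(4) s, where q = "b * d + c"], rule line)
      (simp_all add: algebra_simps)
qed

theorem mainTheorem5:
  fixes n A :: int and S :: "int set" and \<alpha> :: "nat \<Rightarrow> int"
    and C :: "int \<Rightarrow> int \<Rightarrow> int \<Rightarrow> int"
  assumes "n > 0" and "odd n" and "S = {0..<n}"
    and "\<forall>l\<in>{1,2,3}. \<alpha> l \<in> {1..n - 1}"
    and "\<forall>i\<in>S. \<forall>j\<in>S. \<forall>k\<in>S.
           C i j k \<in> S \<and> [C i j k = \<alpha> 1 * i + \<alpha> 2 * j + \<alpha> 3 * k] (mod n)"
    and "A = \<alpha> 1 + \<alpha> 2 + \<alpha> 3"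
    and "\<forall>l\<in>{1,2,3}. gcd (\<alpha> l) n = 1"
    and "\<forall>l\<in>{1,2,3}. \<forall>l'\<in>{1,2,3}. l \<noteq> l' \<longrightarrow>
           gcd (\<alpha> l + \<alpha> l') n = 1 \<and> gcd (\<alpha> l - \<alpha> l') n = 1"
    and "gcd A n = 1"
    and "\<forall>l\<in>{1,2,3}. gcd (A - 2 * \<alpha> l) n = 1"
  shows "pandiagonal_latin_cube n C"
proof -
  note n = \<open>n > 0\<close>
  define a b c where "a = \<alpha> 1" and "b = \<alpha> 2" and "c = \<alpha> 3"
  have C: "C i j k \<in> {0..<n}" "[C i j k = a * i + b * j + c * k] (mod n)"
    if "i \<in> {0..<n}" "j \<in> {0..<n}" "k \<in> {0..<n}" for i j k
    using assms(3,5) that by (auto simp: a_def b_def c_def)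
  \<comment> \<open>With \<open>r\<close> free, matching a square to its affine form becomes a
    polynomial identity over the integers.\<close>
  have C': "C i j k \<in> {0..<n} \<and> [C i j k = r] (mod n)"
    if "i \<in> {0..<n}" "j \<in> {0..<n}" "k \<in> {0..<n}" "a * i + b * j + c * k = r" for i j k r
    using C that by blast
  have refl_in: "n - 1 - i \<in> {0..<n}" if "i \<in> {0..<n}" for i
    using that by auto
  have cop1: "coprime a n" "coprime b n" "coprime c n"
    using assms(7) by (simp_all add: a_def b_def c_def coprime_iff_gcd_eq_1)
  have cop2: "coprime (a + b) n" "coprime (a + c) n" "coprime (b + c) n"
    "coprime (a - b) n" "coprime (a - c) n" "coprime (b - c) n"
    using assms(8) by (simp_all add: a_def b_def c_def coprime_iff_gcd_eq_1)
  \<comment> \<open>Subtracting \<open>2 * \<alpha> l\<close> from \<open>A\<close> flips the sign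
    of one summand.\<close>
  have cop3: "coprime (a + b + c) n" "coprime (b + c - a) n" "coprime (a + c - b) n"
    "coprime (a + b - c) n"
    using assms(9,10)
    by (simp_all add: assms(6) a_def b_def c_def coprime_iff_gcd_eq_1 algebra_simps)
  \<comment> \<open>This is the negative of \<open>A - 2 * \<alpha> 1\<close>, the sign in which it
    occurs as a slope of diagonal squares below.\<close>
  have cop3': "coprime (a - b - c) n"
    using cop3(2) coprime_minus_left_iff[of "b + c - a" n] by (simp add: algebra_simps)
  note affine = affine_imp_pandiagonal_latin_square[OF n]
  \<comment> \<open>Fixing a coordinate leaves two of the coefficients, so only they and their
    pairwise sum and difference occur as slopes.\<close>
  have "pandiagonal_latin_square n (\<lambda>j k. C i j k)" if "i \<in> {0..<n}" for i
    by (rule affine[where a = b and b = c and c = "a * i"])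
      (use cop1 cop2 that in \<open>(simp; fail | intro C'; simp add: algebra_simps)+\<close>)
  moreover have "pandiagonal_latin_square n (\<lambda>i k. C i j k)" if "j \<in> {0..<n}" for j
    by (rule affine[where a = a and b = c and c = "b * j"])
      (use cop1 cop2 that in \<open>(simp; fail | intro C'; simp add: algebra_simps)+\<close>)
  moreover have "pandiagonal_latin_square n (\<lambda>i j. C i j k)" if "k \<in> {0..<n}" for k
    by (rule affine[where a = a and b = b and c = "c * k"])
      (use cop1 cop2 that in \<open>(simp; fail | intro C'; simp add: algebra_simps)+\<close>)
  \<comment> \<open>A repeated index merges two coefficients into their sum: the broken diagonals
    have slopes \<open>A\<close> and \<open>A - 2 * \<alpha> 3\<close>.\<close>
  moreover have "pandiagonal_latin_square n (\<lambda>i k. C i i k)"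
  proof (rule affine[where a = "a + b" and b = "c" and c = "0"])
    show "coprime (a + b) n" "coprime (c) n" using cop1 cop2 by simp_all
    show "coprime (a + b + (c)) n" "coprime (a + b - (c)) n"
      using cop3 cop3' by (simp_all add: algebra_simps)
  qed (rule C'; (rule refl_in)?; simp add: algebra_simps)
  \<comment> \<open>Since \<open>b * (n - 1 - i) = b * (n - 1) - b * i\<close>, a reflected index
    merges two coefficients into their difference and contributes a constant.\<close>
  moreover have "pandiagonal_latin_square n (\<lambda>i k. C i (n - 1 - i) k)"
  proof (rule affine[where a = "a - b" and b = "c" and c = "b * (n - 1)"])
    show "coprime (a - b) n" "coprime (c) n" using cop1 cop2 by simp_all
    show "coprime (a - b + (c)) n" "coprime (a - b - (c)) n"
      using cop3 cop3' by (simp_all add: algebra_simps)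
  qed (rule C'; (rule refl_in)?; simp add: algebra_simps)
  moreover have "pandiagonal_latin_square n (\<lambda>i j. C i j i)"
  proof (rule affine[where a = "a + c" and b = "b" and c = "0"])
    show "coprime (a + c) n" "coprime (b) n" using cop1 cop2 by simp_all
    show "coprime (a + c + (b)) n" "coprime (a + c - (b)) n"
      using cop3 cop3' by (simp_all add: algebra_simps)
  qed (rule C'; (rule refl_in)?; simp add: algebra_simps)
  moreover have "pandiagonal_latin_square n (\<lambda>i j. C i j (n - 1 - i))"
  proof (rule affine[where a = "a - c" and b = "b" and c = "c * (n - 1)"])
    show "coprime (a - c) n" "coprime (b) n" using cop1 cop2 by simp_all
    show "coprime (a - c + (b)) n" "coprime (a - c - (b)) n"
      using cop3 cop3' by (simp_all add: algebra_simps)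
  qed (rule C'; (rule refl_in)?; simp add: algebra_simps)
  \<comment> \<open>In the last two squares the merged coefficient belongs to the second index, so
    \<open>a\<close> stands alone as the first.\<close>
  moreover have "pandiagonal_latin_square n (\<lambda>i j. C i j j)"
  proof (rule affine[where a = "a" and b = "b + c" and c = "0"])
    show "coprime (a) n" "coprime (b + c) n" using cop1 cop2 by simp_all
    show "coprime (a + (b + c)) n" "coprime (a - (b + c)) n"
      using cop3 cop3' by (simp_all add: algebra_simps)
  qed (rule C'; (rule refl_in)?; simp add: algebra_simps)
  moreover have "pandiagonal_latin_square n (\<lambda>i j. C i j (n - 1 - j))"
  proof (rule affine[where a = "a" and b = "b - c" and c = "c * (n - 1)"])
    show "coprime (a) n" "coprime (b - c) n" using cop1 cop2 by simp_all
    show "coprime (a + (b - c)) n" "coprime (a - (b - c)) n"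
      using cop3 cop3' by (simp_all add: algebra_simps)
  qed (rule C'; (rule refl_in)?; simp add: algebra_simps)
  ultimately show ?thesis
    unfolding pandiagonal_latin_cube_def constituent_squares_def
    using C(1) by blast
qed

end
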